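(* For $|q|<1$ (equivalently, as formal power series in $q$), $$\sum_{\lambda\in\mathcal{P}_1'}q^{|\lambda|}=\sum_{n=0}^{\infty}\frac{q^{4n}(-q^{-3};q^4)_n}{(q^2;q^2)_{2n}}+\sum_{n=0}^{\infty}\frac{q^{4n+2}(-q;q^4)_n}{(q^2;q^2)_{2n+1}}=\frac{1}{(q,q^4,q^5,q^6,q^8;q^8)_{\infty}}$$ and $$\sum_{\lambda\in\mathcal{P}_2'}q^{|\lambda|}=\sum_{n=0}^{\infty}\frac{q^{4n}(-q^{-1};q^4)_n}{(q^2;q^2)_{2n}}+\sum_{n=0}^{\infty}\frac{q^{4n+2}(-q^3;q^4)_{n}}{(q^2;q^2)_{2n+1}}=\frac{1}{(q^2,q^3,q^4,q^7,q^8;q^8)_{\infty}}.$$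
   Context: A partition is a finite weakly decreasing sequence of positive integers $\lambda=(\lambda_1,\ldots,\lambda_\ell)$ (the empty partition is included), of weight $|\lambda|=\lambda_1+\cdots+\lambda_\ell$. The odd-indexed parts are $\lambda_1,\lambda_3,\ldots$ and the even-indexed parts are $\lambda_2,\lambda_4,\ldots$. $\mathcal{P}_1'$ is the set of partitions whose even-indexed parts are all even; $\mathcal{P}_2'$ is the set of partitions whose odd-indexed parts are all even (both contain the empty partition). Notation: $(a;q)_0=1$, $(a;q)_n=\prod_{i=0}^{n-1}(1-aq^i)$, $(a;q)_\infty=\lim_{n\to\infty}(a;q)_n$, and $(a_1,\ldots,a_k;q)_\infty=(a_1;q)_\infty\cdots(a_k;q)_\infty$. Negative powers of $q$ cancel against the factors $q^{4n}$. *)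

theory Defs
  imports "HOL-Analysis.Analysis"
begin

text \<open>A partition is the list of its parts. Lists are indexed from 0, so the part
  \<open>\<lambda>\<^sub>i\<close> is \<open>xs ! (i - 1)\<close>; the weight is \<open>sum_list xs\<close>.\<close>

definition is_partition :: "nat list \<Rightarrow> bool" where
  "is_partition xs \<longleftrightarrow> sorted_wrt (\<ge>) xs \<and> (\<forall>x\<in>set xs. 0 < x)"

definition P1' :: "nat list set" where
  "P1' = {xs. is_partition xs \<and> (\<forall>i\<in>{1..length xs}. even i \<longrightarrow> even (xs ! (i - 1)))}"

definition P2' :: "nat list set" where
  "P2' = {xs. is_partition xs \<and> (\<forall>i\<in>{1..length xs}. odd i \<longrightarrow> even (xs ! (i - 1)))}"

text \<open>A negative power of \<open>q\<close> in the argument \<open>a\<close> occurs only in products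
  \<open>q ^ (4 * n) * qpoch a (q ^ 4) n\<close> with \<open>a = - (q powi (-3))\<close> or \<open>a = - (q powi (-1))\<close>. At
  \<open>q = 0\<close> these are 1 for \<open>n = 0\<close> and 0 for \<open>n \<ge> 1\<close>, the same as the values of the polynomials
  in \<open>q\<close> obtained by cancellation.\<close>

definition qpoch :: "complex \<Rightarrow> complex \<Rightarrow> nat \<Rightarrow> complex" where
  "qpoch a q n = (\<Prod>i<n. 1 - a * q ^ i)"

definition qpoch_inf :: "complex \<Rightarrow> complex \<Rightarrow> complex" where
  "qpoch_inf a q = lim (qpoch a q)"

text \<open>The limit exists in the range where it is used.\<close>

lemma qpoch_LIMSEQ:
  assumes "norm q < 1"
  shows "qpoch a q \<longlonglongrightarrow> qpoch_inf a q"
proof -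
  have "summable (\<lambda>i. norm a * norm q ^ i)"
    using assms by (intro summable_mult summable_geometric) auto
  then have "abs_convergent_prod (\<lambda>i. 1 - a * q ^ i)"
    by (simp add: abs_convergent_prod_conv_summable norm_mult norm_power)
  then have "convergent (\<lambda>n. \<Prod>i\<le>n. 1 - a * q ^ i)"
    by (intro convergent_prod_imp_convergent abs_convergent_prod_imp_convergent_prod)
  then have "convergent (\<lambda>n. qpoch a q (Suc n))"
    by (simp add: qpoch_def lessThan_Suc_atMost)
  then have "convergent (qpoch a q)"
    by (simp add: convergent_Suc_iff)
  then show ?thesis
    by (simp add: qpoch_inf_def convergent_LIMSEQ_iff)
qed

definition qpochs_inf :: "complex list \<Rightarrow> complex \<Rightarrow> complex" where
  "qpochs_inf as q = (\<Prod>a\<leftarrow>as. qpoch_inf a q)"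

end

(* In a partition whose parts are even except possibly at a set F of pairwise non-adjacent
   positions, an odd part at position i (counted from 0) can be made even by subtracting 1 from it
   and 2 from each of the i parts before it: its predecessor is even, so the sequence stays
   decreasing. Recording the modified positions gives a bijection with pairs of a partition into
   even parts and a finite subset of F, hence the generating function
   prod_{i in F} (1 + q^(2i+1)) / (q^2; q^2)_oo. The two cases of the theorem are the even and the
   odd i, with numerators (-q; q^4)_oo and (-q^3; q^4)_oo, and both series telescope to the same
   quotients. *)

theory Submission
  imports Defs
begin

section \<open>Partitions with odd parts confined to given positions\<close>

text \<open>\<open>F\<close> is the set of 0-based positions at which odd parts are allowed. Padding by zeros to
  length \<open>k\<close> turns "at most \<open>k\<close> parts" into "exactly \<open>k\<close> entries".\<close>

definition padded :: "nat set \<Rightarrow> nat \<Rightarrow> nat list set" where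
  "padded F k = {xs. length xs = k \<and> sorted_wrt (\<ge>) xs \<and> (\<forall>i<k. i \<notin> F \<longrightarrow> even (xs ! i))}"

definition restricted_partitions :: "nat set \<Rightarrow> nat list set" where
  "restricted_partitions F =
     {xs. is_partition xs \<and> (\<forall>i<length xs. i \<notin> F \<longrightarrow> even (xs ! i))}"

text \<open>What position \<open>i\<close> contributes: the denominator counts additions of 2 to
  each of the first \<open>i + 1\<close> entries, the numerator the optional odd correction, of
  weight \<open>2 * i + 1\<close>.\<close>

definition gf_factor :: "nat set \<Rightarrow> complex \<Rightarrow> nat \<Rightarrow> complex" where
  "gf_factor F q i = (1 + (if i \<in> F then q ^ (2 * i + 1) else 0)) / (1 - q ^ (2 * i + 2))"

text \<open>Passing from indices starting at 1 to positions starting at 0 flips parity, so the odd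
  parts are allowed at the even positions.\<close>

lemma P1'_eq: "P1' = restricted_partitions {i. even i}"
proof -
  have "(\<forall>i\<in>{1..length xs}. even i \<longrightarrow> even (xs ! (i - 1))) \<longleftrightarrow>
        (\<forall>i<length xs. odd i \<longrightarrow> even (xs ! i))" for xs :: "nat list"
    by (auto simp: Suc_le_eq gr0_conv_Suc Ball_def)
  then show ?thesis
    by (simp add: P1'_def restricted_partitions_def)
qed

lemma P2'_eq: "P2' = restricted_partitions {i. odd i}"
proof -
  have "(\<forall>i\<in>{1..length xs}. odd i \<longrightarrow> even (xs ! (i - 1))) \<longleftrightarrow>
        (\<forall>i<length xs. even i \<longrightarrow> even (xs ! i))" for xs :: "nat list"
    by (auto simp: Suc_le_eq gr0_conv_Suc Ball_def)
  then show ?thesis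
    by (simp add: P2'_def restricted_partitions_def)
qed

section \<open>Generating function of padded sequences of fixed length\<close>

lemma has_sum_mult_Times:
  fixes f :: "'a \<Rightarrow> complex" and g :: "'b \<Rightarrow> complex"
  assumes "(f has_sum a) A" "(g has_sum b) B"
  shows "((\<lambda>(x, y). f x * g y) has_sum a * b) (A \<times> B)"
proof (rule has_sum_SigmaI)
  show "((\<lambda>y. case (x, y) of (x, y) \<Rightarrow> f x * g y) has_sum f x * b) B" for x
    using has_sum_cmult_right[OF assms(2)] by simp
  show "((\<lambda>x. f x * b) has_sum a * b) A"
    using has_sum_cmult_left[OF assms(1)] by simp
  \<comment> \<open>For complex terms summability is absolute, and absolute summability passes to
    the product set.\<close>
  have "(\<lambda>x. norm (f x)) summable_on A" "(\<lambda>x. norm (g x)) summable_on B"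
    using assms by (simp_all only: summable_on_iff_abs_summable_on_complex [symmetric] has_sum_imp_summable)
  then have "(\<lambda>u. norm (case u of (x, y) \<Rightarrow> f x * g y)) summable_on A \<times> B"
    by (subst Infinite_Sum.abs_summable_on_Sigma_iff)
       (auto simp: norm_mult infsum_cmult_right abs_mult infsum_nonneg intro!: summable_on_cmult_right summable_on_cmult_left)
  then show "(\<lambda>(x, y). f x * g y) summable_on A \<times> B"
    by (rule abs_summable_summable)
qed

text \<open>The inverse of removing the last entry \<open>2 * j + e\<close>. When \<open>e = 1\<close> the entry before it is even,
  so all earlier entries are at least \<open>2 * j + 2\<close>.\<close>

definition lift_padded :: "nat \<Rightarrow> nat \<Rightarrow> nat list \<Rightarrow> nat list" where
  "lift_padded j e zs = map (\<lambda>x. x + (2 * j + 2 * e)) zs @ [2 * j + e]"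

lemma sum_list_lift_padded:
  "sum_list (lift_padded j e zs) =
     (2 * length zs + 2) * j + (2 * length zs + 1) * e + sum_list zs"
  by (simp add: lift_padded_def sum_list_addf sum_list_triv algebra_simps)

text \<open>The last entry determines \<open>j\<close> and \<open>e\<close> as its quotient and
  remainder modulo 2, and the shift of the earlier entries is even, so it respects their parities.
  Non-adjacency of \<open>F\<close> enters in surjectivity.\<close>

lemma bij_betw_lift_padded:
  assumes "\<And>i. i \<in> F \<Longrightarrow> Suc i \<notin> F"
  shows "bij_betw (\<lambda>(j, e, zs). lift_padded j e zs)
           (UNIV \<times> (if k \<in> F then {0, 1} else {0}) \<times> padded F k) (padded F (Suc k))"
proof (rule bij_betwI')
  let ?D = "UNIV \<times> (if k \<in> F then {0, 1} else {0}) \<times> padded F k"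
  fix u v :: "nat \<times> nat \<times> nat list"
  assume "u \<in> ?D" "v \<in> ?D"
  moreover obtain j e zs j' e' zs' where uv: "u = (j, e, zs)" "v = (j', e', zs')"
    by (metis prod_cases3)
  ultimately have "e < 2" "e' < 2" by (auto split: if_splits)
  have "u = v" if eq: "lift_padded j e zs = lift_padded j' e' zs'"
  proof -
    from eq have je: "2 * j + e = 2 * j' + e'" by (simp add: lift_padded_def)
    then have "e = e'" using \<open>e < 2\<close> \<open>e' < 2\<close> by presburger
    moreover from this je have "j = j'" by simp
    ultimately show ?thesis using eq by (simp add: uv lift_padded_def inj_map_eq_map inj_def)
  qed
  then show "((\<lambda>(j, e, zs). lift_padded j e zs) u = (\<lambda>(j, e, zs). lift_padded j e zs) v) = (u = v)"
    by (auto simp: uv)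
next
  fix u :: "nat \<times> nat \<times> nat list"
  assume "u \<in> UNIV \<times> (if k \<in> F then {0, 1} else {0}) \<times> padded F k"
  then show "(\<lambda>(j, e, zs). lift_padded j e zs) u \<in> padded F (Suc k)"
    by (auto simp: lift_padded_def padded_def sorted_wrt_append sorted_wrt_map nth_append less_Suc_eq
        split: if_splits)
next
  fix ys assume ys: "ys \<in> padded F (Suc k)"
  then have "ys \<noteq> []" by (auto simp: padded_def)
  then obtain ws c where ws: "ys = ws @ [c]" by (metis append_butlast_last_id)
  define j e where "j = c div 2" and "e = c mod 2"
  have c: "c = 2 * j + e" by (simp add: j_def e_def)
  have e: "e \<in> (if k \<in> F then {0, 1} else {0})"
    using ys by (auto simp: padded_def ws e_def nth_append split: if_splits)
  have len: "length ws = k" and sorted: "sorted_wrt (\<ge>) ws"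
    and ge_c: "\<And>x. x \<in> set ws \<Longrightarrow> c \<le> x"
    and ev: "\<And>i. i < k \<Longrightarrow> i \<notin> F \<Longrightarrow> even (ws ! i)"
    using ys by (auto simp: padded_def ws sorted_wrt_append nth_append less_Suc_eq)
  \<comment> \<open>Subtraction on \<open>nat\<close> truncates; this bound makes the subtraction in
    \<open>zs\<close> reversible.\<close>
  have ge: "2 * j + 2 * e \<le> ws ! i" if i: "i < k" for i
  proof (cases "e = 0")
    case True
    then show ?thesis using ge_c[of "ws ! i"] that len c by auto
  next
    case False
    then have "e = 1" "k \<in> F" using e by (simp_all split: if_splits)
    obtain m where m: "k = Suc m" using i gr0_conv_Suc by (metis not_less0 not_gr0)
    have "m \<notin> F" using \<open>k \<in> F\<close> assms[of m] unfolding m by blast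
    then have "even (ws ! m)" using ev[of m] unfolding m by blast
    moreover have "c \<le> ws ! m" by (rule ge_c) (simp add: len m)
    \<comment> \<open>An even entry not below the odd number \<open>c\<close> is at least
      \<open>c + 1\<close>, which equals \<open>2 * j + 2 * e\<close>.\<close>
    ultimately have "c + 1 \<le> ws ! m" using c \<open>e = 1\<close> by presburger
    also have "ws ! m \<le> ws ! i"
    proof (cases "i = m")
      case False
      then show ?thesis using sorted_wrt_nth_less[OF sorted, of i m] i by (simp add: len m)
    qed simp
    finally show ?thesis using c \<open>e = 1\<close> by simp
  qed
  define zs where "zs = map (\<lambda>x. x - (2 * j + 2 * e)) ws"
  have "ws = map (\<lambda>x. x + (2 * j + 2 * e)) zs"
    using ge len by (auto simp: zs_def intro!: nth_equalityI)
  then have "ys = lift_padded j e zs"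
    by (simp add: ws c lift_padded_def)
  moreover have "zs \<in> padded F k"
    using sorted ev ge len
    by (auto simp: padded_def zs_def sorted_wrt_iff_nth_less diff_le_mono)
  ultimately show "\<exists>u\<in>UNIV \<times> (if k \<in> F then {0, 1} else {0}) \<times> padded F k.
      ys = (\<lambda>(j, e, zs). lift_padded j e zs) u"
    using e by (intro bexI[of _ "(j, e, zs)"]) auto
qed

text \<open>Under the bijection the weight is additive in \<open>j\<close>, \<open>e\<close> and
  \<open>zs\<close>, so the sum over length \<open>k + 1\<close> factors into a geometric series in
  \<open>q ^ (2 * k + 2)\<close>, a sum of at most two terms, and the sum over length
  \<open>k\<close>.\<close>

lemma has_sum_padded:
  assumes "\<And>i. i \<in> F \<Longrightarrow> Suc i \<notin> F" and "norm q < 1"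
  shows "((\<lambda>xs. q ^ sum_list xs) has_sum (\<Prod>i<k. gf_factor F q i)) (padded F k)"
proof (induction k)
  case 0
  have "padded F 0 = {[]}" by (auto simp: padded_def)
  then show ?case by (simp add: has_sum_finite_iff)
next
  case (Suc k)
  let ?E = "if k \<in> F then {0, 1} else {0 :: nat}"
  have "norm (q ^ (2 * k + 2)) < 1"
    using assms(2) by (simp add: norm_power power_less_one_iff del: power_Suc)
  then have "((\<lambda>j. (q ^ (2 * k + 2)) ^ j) has_sum 1 / (1 - q ^ (2 * k + 2))) UNIV"
    by (intro norm_summable_imp_has_sum geometric_sums) (simp_all add: norm_power summable_geometric)
  moreover have "((\<lambda>e. (q ^ (2 * k + 1)) ^ e) has_sum (1 + (if k \<in> F then q ^ (2 * k + 1) else 0))) ?E"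
    by (rule has_sum_finiteI) auto
  ultimately have "((\<lambda>(j, e, zs). (q ^ (2 * k + 2)) ^ j * ((q ^ (2 * k + 1)) ^ e * q ^ sum_list zs))
      has_sum 1 / (1 - q ^ (2 * k + 2)) *
        ((1 + (if k \<in> F then q ^ (2 * k + 1) else 0)) * (\<Prod>i<k. gf_factor F q i)))
      (UNIV \<times> ?E \<times> padded F k)"
    using has_sum_mult_Times[OF _ has_sum_mult_Times[OF _ Suc]]
    unfolding case_prod_unfold by blast
  also have "1 / (1 - q ^ (2 * k + 2)) *
        ((1 + (if k \<in> F then q ^ (2 * k + 1) else 0)) * (\<Prod>i<k. gf_factor F q i)) =
        (\<Prod>i<Suc k. gf_factor F q i)"
    by (simp add: gf_factor_def)
  finally have "((\<lambda>(j, e, zs). (q ^ (2 * k + 2)) ^ j * ((q ^ (2 * k + 1)) ^ e * q ^ sum_list zs))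
      has_sum (\<Prod>i<Suc k. gf_factor F q i)) (UNIV \<times> ?E \<times> padded F k)" .
  also have "?this \<longleftrightarrow> ((\<lambda>u. q ^ sum_list ((\<lambda>(j, e, zs). lift_padded j e zs) u))
      has_sum (\<Prod>i<Suc k. gf_factor F q i)) (UNIV \<times> ?E \<times> padded F k)"
  proof (rule has_sum_cong, clarify)
    fix j e zs assume "zs \<in> padded F k"
    then have "length zs = k" by (simp add: padded_def)
    then show "(q ^ (2 * k + 2)) ^ j * ((q ^ (2 * k + 1)) ^ e * q ^ sum_list zs) =
        q ^ sum_list (lift_padded j e zs)"
      by (simp only: sum_list_lift_padded power_add power_mult mult.assoc)
  qed
  also have "\<dots> \<longleftrightarrow> ((\<lambda>xs. q ^ sum_list xs) has_sum (\<Prod>i<Suc k. gf_factor F q i)) (padded F (Suc k))"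
    by (rule has_sum_reindex_bij_betw[OF bij_betw_lift_padded[OF assms(1)]])
  finally show ?case .
qed

section \<open>From padded sequences to partitions of bounded length\<close>

text \<open>In a decreasing list everything after a zero is zero, so the zeros form a final
  block.\<close>

lemma filter_pos_append_zeros:
  assumes "sorted_wrt (\<ge>) (xs :: nat list)"
  shows "filter ((<) 0) xs @ replicate (length xs - length (filter ((<) 0) xs)) 0 = xs"
  using assms
proof (induction xs)
  case (Cons x xs)
  show ?case
  proof (cases "x = 0")
    case True
    then have "xs = replicate (length xs) 0" and "filter ((<) 0) xs = []"
      using Cons.prems by (auto simp: filter_empty_conv intro: replicate_eqI)
    then show ?thesis using True by simp
  next
    case False
    then show ?thesis using Cons by simp
  qed
qed simp

text \<open>Dropping zeros inverts the padding. Zeros are even, so padding never violates a parity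
  condition.\<close>

lemma bij_betw_pad:
  "bij_betw (\<lambda>xs. xs @ replicate (k - length xs) 0)
     {xs \<in> restricted_partitions F. length xs \<le> k} (padded F k)"
proof (rule bij_betw_byWitness[where f' = "filter ((<) 0)"])
  show "\<forall>xs\<in>{xs \<in> restricted_partitions F. length xs \<le> k}.
          filter ((<) 0) (xs @ replicate (k - length xs) 0) = xs"
    by (auto simp: restricted_partitions_def is_partition_def intro: filter_True)
  show "\<forall>ys\<in>padded F k. filter ((<) 0) ys @ replicate (k - length (filter ((<) 0) ys)) 0 = ys"
    using filter_pos_append_zeros by (auto simp: padded_def)
  show "(\<lambda>xs. xs @ replicate (k - length xs) 0) ` {xs \<in> restricted_partitions F. length xs \<le> k}
          \<subseteq> padded F k"
    by (auto simp: restricted_partitions_def is_partition_def padded_def sorted_wrt_append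
        nth_append sorted_wrt_iff_nth_less)
  show "filter ((<) 0) ` padded F k \<subseteq> {xs \<in> restricted_partitions F. length xs \<le> k}"
  proof clarify
    fix ys assume ys: "ys \<in> padded F k"
    let ?xs = "filter ((<) 0) ys"
    have len: "length ?xs \<le> k"
      using ys length_filter_le[of "(<) 0" ys] by (simp add: padded_def)
    have "?xs ! i = ys ! i" if "i < length ?xs" for i
      using that filter_pos_append_zeros[of ys] ys by (metis (mono_tags, lifting) mem_Collect_eq nth_append padded_def)
    then show "?xs \<in> restricted_partitions F \<and> length ?xs \<le> k"
      using ys len by (auto simp: padded_def restricted_partitions_def is_partition_def sorted_wrt_filter)
  qed
qed

lemma has_sum_restricted_partitions_le:
  assumes "\<And>i. i \<in> F \<Longrightarrow> Suc i \<notin> F" and "norm q < 1"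
  shows "((\<lambda>xs. q ^ sum_list xs) has_sum (\<Prod>i<k. gf_factor F q i))
           {xs \<in> restricted_partitions F. length xs \<le> k}"
  using has_sum_reindex_bij_betw[OF bij_betw_pad[of k F], of "\<lambda>xs. q ^ sum_list xs" "\<Prod>i<k. gf_factor F q i"]
    has_sum_padded[OF assms, of k]
  by (simp add: sum_list_replicate)

section \<open>Nonvanishing and factorization of infinite q-products\<close>

lemma qpoch_factor_nonzero:
  fixes a q :: complex
  assumes "norm q < 1" "norm a < 1"
  shows "1 - a * q ^ i \<noteq> 0"
proof -
  have "norm (a * q ^ i) \<le> norm a * 1"
    unfolding norm_mult norm_power using assms by (intro mult_left_mono power_le_one) auto
  then have "norm (a * q ^ i) < norm (1 :: complex)" using assms by simp
  then show ?thesis by (metis eq_iff_diff_eq_0 less_irrefl)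
qed

lemma qpoch_nonzero:
  assumes "norm q < 1" "norm a < 1"
  shows "qpoch a q n \<noteq> 0"
  using qpoch_factor_nonzero[OF assms] by (simp add: qpoch_def)

text \<open>The product converges absolutely and no factor vanishes, so its limit is
  nonzero.\<close>

lemma qpoch_inf_nonzero:
  assumes "norm q < 1" "norm a < 1"
  shows "qpoch_inf a q \<noteq> 0"
proof -
  note nz = qpoch_factor_nonzero[OF assms]
  have "summable (\<lambda>i. norm a * norm q ^ i)"
    using assms by (intro summable_mult summable_geometric) auto
  then have "abs_convergent_prod (\<lambda>i. 1 - a * q ^ i)"
    by (simp add: abs_convergent_prod_conv_summable norm_mult norm_power)
  then have conv: "convergent_prod (\<lambda>i. 1 - a * q ^ i)"
    by (rule abs_convergent_prod_imp_convergent_prod)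
  have "qpoch_inf a q = (\<Prod>i. 1 - a * q ^ i)"
    unfolding qpoch_inf_def qpoch_def [abs_def] using prodinf_eq_lim'[OF conv nz] by simp
  then show ?thesis using prodinf_nonzero[OF conv nz] by simp
qed

text \<open>Factors with even and odd index are collected separately, along the partial products of
  even length.\<close>

lemma qpoch_inf_split:
  assumes "norm q < 1"
  shows "qpoch_inf a q = qpoch_inf a (q ^ 2) * qpoch_inf (a * q) (q ^ 2)"
proof -
  have q2: "norm (q ^ 2) < 1"
    using assms by (simp add: norm_power power_less_one_iff)
  have "qpoch a q (2 * n) = qpoch a (q ^ 2) n * qpoch (a * q) (q ^ 2) n" for n
    by (induction n) (simp_all add: qpoch_def power_mult power2_eq_square power_mult_distrib)
  moreover have "(\<lambda>n. qpoch a q (2 * n)) \<longlonglongrightarrow> qpoch_inf a q"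
    using LIMSEQ_subseq_LIMSEQ[OF qpoch_LIMSEQ[OF assms], of "\<lambda>n. 2 * n"]
    by (simp add: strict_mono_def o_def)
  moreover have "(\<lambda>n. qpoch a (q ^ 2) n * qpoch (a * q) (q ^ 2) n)
      \<longlonglongrightarrow> qpoch_inf a (q ^ 2) * qpoch_inf (a * q) (q ^ 2)"
    by (intro tendsto_mult qpoch_LIMSEQ q2)
  ultimately show ?thesis using LIMSEQ_unique by simp
qed

text \<open>Difference of squares in each factor.\<close>

lemma qpoch_inf_mult_minus:
  assumes "norm q < 1"
  shows "qpoch_inf a q * qpoch_inf (- a) q = qpoch_inf (a ^ 2) (q ^ 2)"
proof -
  have q2: "norm (q ^ 2) < 1"
    using assms by (simp add: norm_power power_less_one_iff)
  have "qpoch a q n * qpoch (- a) q n = qpoch (a ^ 2) (q ^ 2) n" for n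
    by (simp add: qpoch_def algebra_simps power2_eq_square power_mult_distrib flip: prod.distrib)
  moreover have "(\<lambda>n. qpoch a q n * qpoch (- a) q n) \<longlonglongrightarrow> qpoch_inf a q * qpoch_inf (- a) q"
    by (intro tendsto_mult qpoch_LIMSEQ assms)
  ultimately show ?thesis
    using LIMSEQ_unique qpoch_LIMSEQ[OF q2, of "a ^ 2"] by simp
qed

section \<open>Letting the number of parts tend to infinity\<close>

lemma prod_gf_factor:
  "(\<Prod>i<k. gf_factor F q i) =
     (\<Prod>i<k. 1 + (if i \<in> F then q ^ (2 * i + 1) else 0)) / qpoch (q ^ 2) (q ^ 2) k"
proof -
  have "1 - q ^ 2 * (q ^ 2) ^ i = 1 - q ^ (2 * i + 2)" for i
    by (simp only: power_add power_mult) (simp only: mult.commute)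
  then show ?thesis by (simp only: gf_factor_def qpoch_def prod_dividef)
qed

text \<open>The numerators deviate from 1 by at most a geometric sequence, and the denominators tend
  to a nonzero limit.\<close>

lemma convergent_gf_factor:
  assumes "norm q < 1"
  shows "convergent (\<lambda>k. \<Prod>i<k. gf_factor F q i)"
proof -
  let ?h = "\<lambda>i. 1 + (if i \<in> F then q ^ (2 * i + 1) else 0)"
  have q2: "norm (q ^ 2) < 1"
    using assms by (simp add: norm_power power_less_one_iff)
  have "summable (\<lambda>i. norm (?h i - 1))"
  proof (rule summable_comparison_test'[where N = 0])
    show "summable (\<lambda>i. norm q * norm (q ^ 2) ^ i)"
      using q2 by (intro summable_mult summable_geometric) auto
    show "norm (norm (?h i - 1)) \<le> norm q * norm (q ^ 2) ^ i" for i
      by (simp add: norm_mult norm_power power_mult)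
  qed
  then have "convergent (\<lambda>k. \<Prod>i\<le>k. ?h i)"
    by (intro convergent_prod_imp_convergent abs_convergent_prod_imp_convergent_prod)
       (simp only: abs_convergent_prod_conv_summable)
  then have "convergent (\<lambda>k. \<Prod>i<Suc k. ?h i)"
    by (simp only: lessThan_Suc_atMost)
  then have "convergent (\<lambda>k. \<Prod>i<k. ?h i)"
    by (subst (asm) convergent_Suc_iff)
  then have "(\<lambda>k. \<Prod>i<k. ?h i) \<longlonglongrightarrow> lim (\<lambda>k. \<Prod>i<k. ?h i)"
    by (simp only: convergent_LIMSEQ_iff)
  then show ?thesis
    unfolding prod_gf_factor
    by (rule convergentI[OF tendsto_divide[OF _ qpoch_LIMSEQ[OF q2] qpoch_inf_nonzero[OF q2 q2]]])
qed

text \<open>The bound for absolute convergence comes from the same generating function at \<open>norm q\<close>.\<close>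

lemma has_sum_restricted_partitions:
  assumes F: "\<And>i. i \<in> F \<Longrightarrow> Suc i \<notin> F" and q: "norm q < 1"
  shows "((\<lambda>xs. q ^ sum_list xs) has_sum lim (\<lambda>k. \<Prod>i<k. gf_factor F q i))
           (restricted_partitions F)"
proof -
  let ?f = "\<lambda>xs. q ^ sum_list xs"
  let ?P = "restricted_partitions F" and ?Y = "\<lambda>k. {xs \<in> restricted_partitions F. length xs \<le> k}"
  let ?G = "\<lambda>k. \<Prod>i<k. gf_factor F q i"
  \<comment> \<open>The sum of all lengths in a finite set bounds each of them.\<close>
  have cover: "\<exists>k. X \<subseteq> ?Y k" if "finite X" "X \<subseteq> ?P" for X
    using that by (intro exI[of _ "\<Sum>xs\<in>X. length xs"]) (auto intro: member_le_sum)
  define r where "r = complex_of_real (norm q)"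
  have r: "norm r < 1" using q by (simp add: r_def)
  obtain C where C: "\<And>k. norm (\<Prod>i<k. gf_factor F r i) \<le> C"
    using convergent_imp_Bseq[OF convergent_gf_factor[OF r, of F]] by (auto simp: Bseq_def)
  have bound: "(\<Sum>xs\<in>X. norm (?f xs)) \<le> C" if X: "finite X" "X \<subseteq> ?P" for X
  proof -
    obtain k where k: "X \<subseteq> ?Y k" using cover X by blast
    have "((\<lambda>xs. r ^ sum_list xs) has_sum (\<Prod>i<k. gf_factor F r i)) (?Y k)"
      by (rule has_sum_restricted_partitions_le[OF F r])
    from has_sum_Re[OF this] have "((\<lambda>xs. norm (?f xs)) has_sum Re (\<Prod>i<k. gf_factor F r i)) (?Y k)"
      by (simp add: r_def norm_power flip: of_real_power)
    then have "(\<Sum>xs\<in>X. norm (?f xs)) \<le> Re (\<Prod>i<k. gf_factor F r i)"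
      by (rule has_sum_mono2[OF has_sum_finite[OF X(1)] _ k]) simp
    also have "\<dots> \<le> C" using C[of k] complex_Re_le_cmod order_trans by blast
    finally show ?thesis .
  qed
  have "(\<lambda>xs. norm (?f xs)) summable_on ?P"
    by (rule nonneg_bdd_above_summable_on) (auto intro!: bdd_aboveI2[where M = C] bound)
  then have "?f summable_on ?P" by (rule abs_summable_summable)
  then have S: "(?f has_sum infsum ?f ?P) ?P" by (rule has_sum_infsum)
  have "?G \<longlonglongrightarrow> infsum ?f ?P"
  proof (rule metric_LIMSEQ_I)
    fix e :: real assume "e > 0"
    have "\<forall>\<^sub>F X in finite_subsets_at_top ?P. dist (sum ?f X) (infsum ?f ?P) < e / 2"
      using S[unfolded has_sum_def] by (rule tendstoD) (use \<open>e > 0\<close> in simp)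
    then obtain X0 where X0: "finite X0" "X0 \<subseteq> ?P"
      and near: "\<forall>X. finite X \<and> X0 \<subseteq> X \<and> X \<subseteq> ?P \<longrightarrow> dist (sum ?f X) (infsum ?f ?P) < e / 2"
      unfolding eventually_finite_subsets_at_top by (elim exE conjE)
    obtain K where K: "X0 \<subseteq> ?Y K" using cover[OF X0] by (elim exE)
    \<comment> \<open>The two values are compared through a finite \<open>X\<close> between
      \<open>X0\<close> and \<open>?Y k\<close>: large enough in \<open>?Y k\<close> to be close to
      \<open>?G k\<close>, and close to the full sum because it contains \<open>X0\<close>.\<close>
    have "dist (?G k) (infsum ?f ?P) < e" if "k \<ge> K" for k
    proof -
      have "(?f has_sum ?G k) (?Y k)" by (rule has_sum_restricted_partitions_le[OF F q])
      then have "\<forall>\<^sub>F X in finite_subsets_at_top (?Y k). dist (sum ?f X) (?G k) < e / 2"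
        unfolding has_sum_def by (rule tendstoD) (use \<open>e > 0\<close> in simp)
      moreover have "\<forall>\<^sub>F X in finite_subsets_at_top (?Y k). finite X \<and> X0 \<subseteq> X \<and> X \<subseteq> ?Y k"
        unfolding eventually_finite_subsets_at_top
      proof (intro exI[of _ X0] conjI allI impI)
        show "X0 \<subseteq> ?Y k" using K that by force
      qed (use X0 in simp_all)
      ultimately have "\<forall>\<^sub>F X in finite_subsets_at_top (?Y k).
          dist (sum ?f X) (?G k) < e / 2 \<and> finite X \<and> X0 \<subseteq> X \<and> X \<subseteq> ?Y k"
        by (rule eventually_conj)
      from eventually_happens'[OF finite_subsets_at_top_neq_bot this]
      obtain X where X: "dist (sum ?f X) (?G k) < e / 2" "finite X" "X0 \<subseteq> X" "X \<subseteq> ?Y k"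
        by (elim exE conjE)
      then have "dist (sum ?f X) (infsum ?f ?P) < e / 2"
        by (intro near[rule_format]) auto
      with X(1) show ?thesis by (rule dist_triangle_half_r)
    qed
    then show "\<exists>K. \<forall>k\<ge>K. dist (?G k) (infsum ?f ?P) < e" by blast
  qed
  then show ?thesis using S by (simp add: limI)
qed

text \<open>The closed form of the numerators is given for even lengths, so the limit is evaluated
  along \<open>2 * n\<close>.\<close>

lemma restricted_partitions_gf:
  assumes F: "\<And>i. i \<in> F \<Longrightarrow> Suc i \<notin> F" and q: "norm q < 1"
    and prod: "\<And>n. (\<Prod>i<2 * n. 1 + (if i \<in> F then q ^ (2 * i + 1) else 0)) = qpoch (- z) (q ^ 4) n"
  shows "((\<lambda>xs. q ^ sum_list xs) has_sum qpoch_inf (- z) (q ^ 4) / qpoch_inf (q ^ 2) (q ^ 2))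
           (restricted_partitions F)"
proof -
  have q_less: "norm (q ^ k) < 1" if "k > 0" for k
    using q that by (simp add: norm_power power_less_one_iff)
  let ?G = "\<lambda>k. \<Prod>i<k. gf_factor F q i"
  have sub: "strict_mono (\<lambda>n::nat. 2 * n)" by (simp add: strict_mono_def)
  have "?G \<longlonglongrightarrow> lim ?G"
    using convergent_gf_factor[OF q] by (simp add: convergent_LIMSEQ_iff)
  then have "(\<lambda>n. ?G (2 * n)) \<longlonglongrightarrow> lim ?G"
    using LIMSEQ_subseq_LIMSEQ[OF _ sub] by (simp add: o_def)
  moreover have "(\<lambda>n. qpoch (q ^ 2) (q ^ 2) (2 * n)) \<longlonglongrightarrow> qpoch_inf (q ^ 2) (q ^ 2)"
    using LIMSEQ_subseq_LIMSEQ[OF qpoch_LIMSEQ sub] q_less by (simp add: o_def)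
  then have "(\<lambda>n. ?G (2 * n)) \<longlonglongrightarrow> qpoch_inf (- z) (q ^ 4) / qpoch_inf (q ^ 2) (q ^ 2)"
    unfolding prod_gf_factor prod
    by (intro tendsto_divide qpoch_LIMSEQ qpoch_inf_nonzero q_less) auto
  ultimately have "lim ?G = qpoch_inf (- z) (q ^ 4) / qpoch_inf (q ^ 2) (q ^ 2)"
    by (rule LIMSEQ_unique)
  then show ?thesis using has_sum_restricted_partitions[OF F q] by simp
qed

section \<open>Evaluation of the two series by telescoping\<close>

lemma summable_power_mult_Bseq:
  fixes b :: "nat \<Rightarrow> complex"
  assumes "norm x < 1" "Bseq b"
  shows "summable (\<lambda>n. x ^ n * b n)"
proof -
  obtain C where C: "\<And>n. norm (b n) \<le> C" using assms(2) by (auto simp: Bseq_def)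
  show ?thesis
  proof (rule summable_comparison_test'[where N = 0])
    show "summable (\<lambda>n. C * norm x ^ n)"
      using assms(1) by (intro summable_mult summable_geometric) auto
    show "norm (x ^ n * b n) \<le> C * norm x ^ n" for n
      using C[of n] by (simp add: norm_mult norm_power mult.commute mult_right_mono)
  qed
qed

text \<open>Here \<open>A (n + 1)\<close> is the series term \<open>q\<^bsup>4n+4\<^esup> (- z q\<^bsup>-4\<^esup>; q\<^sup>4)\<^sub>n\<^sub>+\<^sub>1 / (q\<^sup>2; q\<^sup>2)\<^sub>2\<^sub>n\<^sub>+\<^sub>2\<close>
  with the factor \<open>1 + z q\<^bsup>-4\<^esup>\<close> cancelled, so that \<open>q = 0\<close> needs no separate treatment.
  The partial sums of \<open>A + B\<close> telescope.\<close>

lemma series_eq_quotient: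
  fixes q z :: complex
  assumes q: "norm q < 1" and A0: "A 0 = 1"
    and A_Suc: "\<And>n. A (Suc n) = (q ^ (4 * n + 4) + z * q ^ (4 * n)) * qpoch (- z) (q ^ 4) n /
                  qpoch (q ^ 2) (q ^ 2) (2 * n + 2)"
    and B: "\<And>n. B n = q ^ (4 * n + 2) * qpoch (- z) (q ^ 4) n / qpoch (q ^ 2) (q ^ 2) (2 * n + 1)"
  shows "summable A" "summable B"
    and "suminf A + suminf B = qpoch_inf (- z) (q ^ 4) / qpoch_inf (q ^ 2) (q ^ 2)"
proof -
  let ?L = "qpoch_inf (- z) (q ^ 4) / qpoch_inf (q ^ 2) (q ^ 2)"
  have q_less: "norm (q ^ k) < 1" if "k > 0" for k
    using q that by (simp add: norm_power power_less_one_iff)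
  \<comment> \<open>The offset \<open>c\<close> is 2 in the terms of \<open>A\<close>, and 1 in
    those of \<open>B\<close> and in the closed form of the partial sums.\<close>
  have lim: "(\<lambda>n. qpoch (- z) (q ^ 4) n / qpoch (q ^ 2) (q ^ 2) (2 * n + c)) \<longlonglongrightarrow> ?L" for c
  proof -
    have "(\<lambda>n. qpoch (q ^ 2) (q ^ 2) (2 * n + c)) \<longlonglongrightarrow> qpoch_inf (q ^ 2) (q ^ 2)"
      using LIMSEQ_subseq_LIMSEQ[OF qpoch_LIMSEQ, of "q ^ 2" "\<lambda>n. 2 * n + c"] q_less
      by (simp add: o_def strict_mono_def)
    then show ?thesis
      by (intro tendsto_divide qpoch_LIMSEQ qpoch_inf_nonzero q_less) auto
  qed
  have bdd: "Bseq (\<lambda>n. qpoch (- z) (q ^ 4) n / qpoch (q ^ 2) (q ^ 2) (2 * n + c))" for c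
    using lim by (intro convergent_imp_Bseq convergentI)
  have "summable (\<lambda>n. (q ^ 4 + z) * ((q ^ 4) ^ n *
          (qpoch (- z) (q ^ 4) n / qpoch (q ^ 2) (q ^ 2) (2 * n + 2))))"
    by (intro summable_mult summable_power_mult_Bseq q_less bdd) auto
  also have "(\<lambda>n. (q ^ 4 + z) * ((q ^ 4) ^ n *
          (qpoch (- z) (q ^ 4) n / qpoch (q ^ 2) (q ^ 2) (2 * n + 2)))) = (\<lambda>n. A (Suc n))"
    by (rule ext) (simp add: A_Suc power_add algebra_simps flip: power_mult)
  finally show A: "summable A" by (simp add: summable_Suc_iff)
  have "summable (\<lambda>n. q ^ 2 * ((q ^ 4) ^ n *
          (qpoch (- z) (q ^ 4) n / qpoch (q ^ 2) (q ^ 2) (2 * n + 1))))"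
    by (intro summable_mult summable_power_mult_Bseq q_less bdd) auto
  also have "(\<lambda>n. q ^ 2 * ((q ^ 4) ^ n *
          (qpoch (- z) (q ^ 4) n / qpoch (q ^ 2) (q ^ 2) (2 * n + 1)))) = B"
    by (rule ext, simp only: B power_add power_mult) (simp only: times_divide_eq_right mult_ac)
  finally show "summable B" .
  have "(\<Sum>n\<le>N. A n + B n) = qpoch (- z) (q ^ 4) N / qpoch (q ^ 2) (q ^ 2) (2 * N + 1)" for N
  proof (induction N)
    case 0
    have "1 - q ^ 2 \<noteq> 0" using q_less[of 2] by auto
    then have "1 + q ^ 2 / (1 - q ^ 2) = 1 / (1 - q ^ 2)"
      by (metis add_divide_distrib diff_add_cancel divide_self)
    then show ?case by (simp add: A0 B qpoch_def power2_eq_square)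
  next
    case (Suc N)
    \<comment> \<open>In these quantities the induction step is an identity of rational
      functions.\<close>
    define x p d where "x = q ^ (4 * N)" and "p = qpoch (- z) (q ^ 4) N"
      and "d = qpoch (q ^ 2) (q ^ 2) (2 * N + 1)"
    have x: "q ^ (4 * N + k) = x * q ^ k" for k by (simp add: x_def power_add)
    have qpoch_Suc: "qpoch a b (Suc k) = qpoch a b k * (1 - a * b ^ k)" for a b :: complex and k
      by (simp add: qpoch_def)
    have "q ^ 2 * (q ^ 2) ^ (2 * N + 1) = x * q ^ 4"
      unfolding x_def power_mult [symmetric] power_add [symmetric]
      by (rule arg_cong[where f = "power q"]) simp
    then have d2: "qpoch (q ^ 2) (q ^ 2) (2 * N + 2) = d * (1 - x * q ^ 4)"
      using qpoch_Suc[of "q ^ 2" "q ^ 2" "2 * N + 1"] by (simp add: d_def)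
    have "q ^ 2 * (q ^ 2) ^ (2 * N + 2) = x * q ^ 6"
      unfolding x_def power_mult [symmetric] power_add [symmetric]
      by (rule arg_cong[where f = "power q"]) simp
    then have d3: "qpoch (q ^ 2) (q ^ 2) (2 * Suc N + 1) = d * (1 - x * q ^ 4) * (1 - x * q ^ 6)"
      using qpoch_Suc[of "q ^ 2" "q ^ 2" "2 * N + 2"] d2 by simp
    have p1: "qpoch (- z) (q ^ 4) (Suc N) = p * (1 + z * x)"
      by (simp add: qpoch_Suc p_def x_def power_mult)
    have nz: "d \<noteq> 0" "1 - x * q ^ 4 \<noteq> 0" "1 - x * q ^ 6 \<noteq> 0"
      using qpoch_nonzero[OF q_less q_less, of 2 2 "2 * Suc N + 1"] unfolding d3 by auto
    have A': "A (Suc N) = (x * q ^ 4 + z * x) * p / (d * (1 - x * q ^ 4))"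
      by (simp only: A_Suc d2 x p_def x_def)
    have "q ^ (4 * Suc N + 2) = x * q ^ 6"
      unfolding x_def power_add [symmetric] by (rule arg_cong[where f = "power q"]) simp
    then have B': "B (Suc N) = x * q ^ 6 * (p * (1 + z * x)) / (d * (1 - x * q ^ 4) * (1 - x * q ^ 6))"
      by (simp only: B d3 p1)
    have "(\<Sum>n\<le>Suc N. A n + B n) = p / d + (x * q ^ 4 + z * x) * p / (d * (1 - x * q ^ 4)) +
        x * q ^ 6 * (p * (1 + z * x)) / (d * (1 - x * q ^ 4) * (1 - x * q ^ 6))"
      using Suc by (simp only: sum.atMost_Suc A' B' add.assoc p_def d_def)
    also have "\<dots> = p * ((1 - x * q ^ 4) * (1 - x * q ^ 6) + (x * q ^ 4 + z * x) * (1 - x * q ^ 6) +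
        x * q ^ 6 * (1 + z * x)) / (d * (1 - x * q ^ 4) * (1 - x * q ^ 6))"
    proof -
      have "p / d + a * p / (d * u) + b * (p * c) / (d * u * w) = p * (u * w + a * w + b * c) / (d * u * w)"
        if "u \<noteq> 0" "w \<noteq> 0" for a b c u w :: complex
        using that nz(1) by (simp add: field_simps)
      from this[OF nz(2,3)] show ?thesis .
    qed
    \<comment> \<open>The first two summands combine to
      \<open>(1 + z * x) * (1 - x * q ^ 6)\<close>, and the third restores \<open>1 + z * x\<close>,
      the new factor of the numerator.\<close>
    also have "(1 - x * q ^ 4) * (1 - x * q ^ 6) + (x * q ^ 4 + z * x) * (1 - x * q ^ 6) +
        x * q ^ 6 * (1 + z * x) = 1 + z * x"
      by (simp add: algebra_simps)
    finally show ?case by (simp only: p1 d3)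
  qed
  then have "(\<lambda>N. \<Sum>n\<le>N. A n + B n) \<longlonglongrightarrow> ?L" using lim[of 1] by simp
  moreover have "(\<lambda>N. \<Sum>n\<le>N. A n + B n) \<longlonglongrightarrow> suminf A + suminf B"
    using summable_LIMSEQ'[OF summable_add[OF A \<open>summable B\<close>]] suminf_add[OF A \<open>summable B\<close>] by simp
  ultimately show "suminf A + suminf B = ?L" by (rule LIMSEQ_unique[rotated])
qed

section \<open>Products modulo 8 and the two identities\<close>

text \<open>Two rounds of splitting by parity sort the even exponents by their residue modulo
  8.\<close>

lemma qpoch_inf_even_split:
  assumes "norm q < 1"
  shows "qpoch_inf (q ^ 2) (q ^ 2) = qpoch_inf (q ^ 2) (q ^ 8) * qpoch_inf (q ^ 4) (q ^ 8) *
           qpoch_inf (q ^ 6) (q ^ 8) * qpoch_inf (q ^ 8) (q ^ 8)"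
proof -
  have q_less: "norm (q ^ k) < 1" if "k > 0" for k
    using assms that by (simp add: norm_power power_less_one_iff)
  show ?thesis
    using qpoch_inf_split[of "q ^ 2" "q ^ 2"] qpoch_inf_split[of "q ^ 4" "q ^ 2"]
      qpoch_inf_split[of "q ^ 4" "q ^ 4"] q_less
    by (simp flip: power_mult power_add)
qed

text \<open>The difference of squares moves the sign into a quotient, whose denominator is then
  split by parity. With \<open>a = q\<close> or \<open>a = q ^ 3\<close> the new numerator is one of
  the factors of \<open>qpoch_inf (q ^ 2) (q ^ 2)\<close>.\<close>

lemma qpoch_inf_minus_eq:
  assumes "norm q < 1" "norm a < 1"
  shows "qpoch_inf (- a) (q ^ 4) =
           qpoch_inf (a ^ 2) (q ^ 8) / (qpoch_inf a (q ^ 8) * qpoch_inf (a * q ^ 4) (q ^ 8))"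
proof -
  have q_less: "norm (q ^ 4) < 1"
    using assms by (simp add: norm_power power_less_one_iff)
  show ?thesis
    using qpoch_inf_mult_minus[OF q_less, of a] qpoch_inf_split[OF q_less, of a]
      qpoch_inf_nonzero[OF q_less assms(2)]
    by (simp add: field_simps flip: power_mult)
qed

theorem theorem1p5:
  fixes q :: complex
  assumes "norm q < 1"
  defines "A1 \<equiv> \<lambda>n::nat. q ^ (4 * n) * qpoch (- (q powi (-3))) (q ^ 4) n / qpoch (q ^ 2) (q ^ 2) (2 * n)"
      and "B1 \<equiv> \<lambda>n::nat. q ^ (4 * n + 2) * qpoch (- q) (q ^ 4) n / qpoch (q ^ 2) (q ^ 2) (2 * n + 1)"
      and "A2 \<equiv> \<lambda>n::nat. q ^ (4 * n) * qpoch (- (q powi (-1))) (q ^ 4) n / qpoch (q ^ 2) (q ^ 2) (2 * n)"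
      and "B2 \<equiv> \<lambda>n::nat. q ^ (4 * n + 2) * qpoch (- (q ^ 3)) (q ^ 4) n / qpoch (q ^ 2) (q ^ 2) (2 * n + 1)"
  shows "((\<lambda>xs. q ^ sum_list xs) summable_on P1' \<and> summable A1 \<and> summable B1 \<and>
          (\<Sum>\<^sub>\<infinity>xs\<in>P1'. q ^ sum_list xs) = (\<Sum>n. A1 n) + (\<Sum>n. B1 n) \<and>
          (\<Sum>n. A1 n) + (\<Sum>n. B1 n) = 1 / qpochs_inf [q, q ^ 4, q ^ 5, q ^ 6, q ^ 8] (q ^ 8)) \<and>
         ((\<lambda>xs. q ^ sum_list xs) summable_on P2' \<and> summable A2 \<and> summable B2 \<and>
          (\<Sum>\<^sub>\<infinity>xs\<in>P2'. q ^ sum_list xs) = (\<Sum>n. A2 n) + (\<Sum>n. B2 n) \<and>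
          (\<Sum>n. A2 n) + (\<Sum>n. B2 n) = 1 / qpochs_inf [q ^ 2, q ^ 3, q ^ 4, q ^ 7, q ^ 8] (q ^ 8))"
proof -
  have q_less: "norm (q ^ k) < 1" if "k > 0" for k
    using assms(1) that by (simp add: norm_power power_less_one_iff)
  have nz: "qpoch_inf (q ^ k) (q ^ 8) \<noteq> 0" if "k > 0" for k
    using that by (intro qpoch_inf_nonzero q_less) auto
  \<comment> \<open>Isolates the first factor, which \<open>q ^ 4\<close> turns into a polynomial
    when \<open>a\<close> is a negative power of \<open>q\<close>.\<close>
  have shift: "qpoch a (q ^ 4) (Suc n) = (1 - a) * qpoch (a * q ^ 4) (q ^ 4) n" for a n
    by (simp add: qpoch_def prod.lessThan_Suc_shift mult.assoc del: prod.lessThan_Suc)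

  have 1: "((\<lambda>xs. q ^ sum_list xs) has_sum qpoch_inf (- q) (q ^ 4) / qpoch_inf (q ^ 2) (q ^ 2)) P1'"
    unfolding P1'_eq
  proof (rule restricted_partitions_gf)
    \<comment> \<open>Of the positions \<open>2 * n\<close> and \<open>2 * n + 1\<close> only the
      even one contributes, with exponent \<open>2 * (2 * n) + 1 = 4 * n + 1\<close>.\<close>
    show "(\<Prod>i<2 * n. 1 + (if i \<in> {i. even i} then q ^ (2 * i + 1) else 0)) = qpoch (- q) (q ^ 4) n" for n
      by (induction n) (simp_all add: qpoch_def flip: power_mult)
  qed (use assms in auto)
  have A1_Suc: "A1 (Suc n) = (q ^ (4 * n + 4) + q * q ^ (4 * n)) * qpoch (- q) (q ^ 4) n /
      qpoch (q ^ 2) (q ^ 2) (2 * n + 2)" for n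
  proof (cases "q = 0")
    \<comment> \<open>At \<open>q = 0\<close> the powers of \<open>q\<close> in front make both
      sides zero, whatever \<open>0 powi (-3)\<close> is.\<close>
    case True
    then show ?thesis by (cases n) (auto simp: A1_def)
  next
    case False
    then have "- (q powi (-3)) * q ^ 4 = - q" "q ^ 4 * (1 + q powi (-3)) = q ^ 4 + q"
      by (simp_all add: power_int_minus field_simps eval_nat_numeral)
    then show ?thesis
      by (simp add: A1_def shift power_add algebra_simps)
  qed
  have A1_0: "A1 0 = 1" by (simp add: A1_def qpoch_def)
  note S1 = series_eq_quotient[of q A1 q B1, OF assms(1) A1_0 A1_Suc B1_def[THEN meta_eq_to_obj_eq, THEN fun_cong]]
  \<comment> \<open>The numerator \<open>qpoch_inf (q ^ 2) (q ^ 8)\<close> cancels, leaving the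
    residues 4, 6, 0 from the even part and 1, 5 from \<open>- q\<close>.\<close>
  have prod1: "qpoch_inf (- q) (q ^ 4) / qpoch_inf (q ^ 2) (q ^ 2) =
      1 / qpochs_inf [q, q ^ 4, q ^ 5, q ^ 6, q ^ 8] (q ^ 8)"
  proof -
    have "q * q ^ 4 = q ^ 5" by (simp add: eval_nat_numeral)
    then show ?thesis
      using nz[of 2]
      by (simp add: qpochs_inf_def qpoch_inf_minus_eq[OF assms(1) assms(1)]
          qpoch_inf_even_split[OF assms(1)])
  qed

  have 2: "((\<lambda>xs. q ^ sum_list xs) has_sum qpoch_inf (- (q ^ 3)) (q ^ 4) / qpoch_inf (q ^ 2) (q ^ 2)) P2'"
    unfolding P2'_eq
  proof (rule restricted_partitions_gf)
    show "(\<Prod>i<2 * n. 1 + (if i \<in> {i. odd i} then q ^ (2 * i + 1) else 0)) = qpoch (- (q ^ 3)) (q ^ 4) n" for n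
    proof (induction n)
      case (Suc n)
      have "q ^ (2 * (2 * n + 1) + 1) = q ^ 3 * (q ^ 4) ^ n"
        by (simp add: power_add mult.commute numeral_3_eq_3 flip: power_mult)
      with Suc show ?case by (simp add: qpoch_def)
    qed (simp add: qpoch_def)
  qed (use assms in auto)
  have A2_Suc: "A2 (Suc n) = (q ^ (4 * n + 4) + q ^ 3 * q ^ (4 * n)) * qpoch (- (q ^ 3)) (q ^ 4) n /
      qpoch (q ^ 2) (q ^ 2) (2 * n + 2)" for n
  proof (cases "q = 0")
    case True
    then show ?thesis by (cases n) (auto simp: A2_def)
  next
    case False
    then have "- (q powi (-1)) * q ^ 4 = - (q ^ 3)" "q ^ 4 * (1 + q powi (-1)) = q ^ 4 + q ^ 3"
      by (simp_all add: power_int_minus field_simps eval_nat_numeral)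
    then show ?thesis
      by (simp add: A2_def shift power_add algebra_simps)
  qed
  have A2_0: "A2 0 = 1" by (simp add: A2_def qpoch_def)
  note S2 = series_eq_quotient[of q A2 "q ^ 3" B2, OF assms(1) A2_0 A2_Suc B2_def[THEN meta_eq_to_obj_eq, THEN fun_cong]]
  \<comment> \<open>Here the numerator is \<open>qpoch_inf (q ^ 6) (q ^ 8)\<close>, so residue 6
    cancels and 3, 7 appear.\<close>
  have prod2: "qpoch_inf (- (q ^ 3)) (q ^ 4) / qpoch_inf (q ^ 2) (q ^ 2) =
      1 / qpochs_inf [q ^ 2, q ^ 3, q ^ 4, q ^ 7, q ^ 8] (q ^ 8)"
  proof -
    have "q ^ 3 * q ^ 4 = q ^ 7" "(q ^ 3) ^ 2 = q ^ 6" by (simp_all flip: power_add power_mult)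
    then show ?thesis
      using nz[of 6]
      by (simp add: qpochs_inf_def qpoch_inf_minus_eq[OF assms(1) q_less]
          qpoch_inf_even_split[OF assms(1)])
  qed

  show ?thesis
    using S1(1,2) S2(1,2) has_sum_imp_summable[OF 1] has_sum_imp_summable[OF 2]
    by (simp only: S1(3) S2(3) infsumI[OF 1] infsumI[OF 2] prod1 prod2 simp_thms)
qed

end
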